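(* Let $R$ be an integral domain that is not a field. Then the following are equivalent. (1) $R$ is a one-dimensional quasi-local domain. (2) $\tilde{*}=d$ for every semistar operation $*\neq e$ on $R$. (3) If $*$ is a semistar operation on $R$ that is both stable and of finite type, then either $*=e$ or $*=d$. (4) Every ideal valuation on $R$ is constant on proper ideals of $R$. (5) Every prime valuation on $R$ is constant on nonzero prime ideals of $R$, and at least one ideal valuation on $R$ takes a nonzero value.
   Context: $R$ has quotient field $K$. $\mathcal{S}(R)$ is the set of all ideals of $R$ (including $0$ and $R$), $\mathcal{S}'(R)=\mathcal{S}(R)\setminus\{0,R\}$, $f\mathcal{S}(R)$ the set of finitely generated ideals, $\overline{F}(R)$ the set of nonzero $R$-submodules of $K$, $\overline{\mathbb{N}}=\{0,1,2,\ldots\}\cup\{\infty\}$, and $(I:_KJ)=\{x\in K\mid xJ\subseteq I\}$. A quasi-local domain is an integral domain with exactly one maximal ideal (not necessarily Noetherian). Semistar operation: a map $*:\overline{F}(R)\to\overline{F}(R)$, $I\mapsto I^*$, such that for all $I,J\in\overline{F}(R)$ and $x\in K\setminus\{0\}$: $I\subseteq I^*$; $I\subseteq J$ implies $I^*\subseteq J^*$; $(xI)^*=xI^*$; $(I^* )^*=I^*$. It is stable if $(I\cap J)^*=I^*\cap J^*$ for all $I,J\in\overline{F}(R)$. Put $I^{*_f}=\bigcup\{J^*\mid J\subseteq I,\ J\text{ a nonzero finitely generated }R\text{-submodule of }K\}$; then $*_f$ is a semistar operation, and $*$ is of finite type if $*=*_f$. The semistar operation $\tilde{*}$ is defined by $I^{\tilde{*}}=\bigcup\{(I:_KJ)\mid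 J \text{ a nonzero ideal of } R,\ J^{*_f}=R^{*}\}$ for $I\in\overline{F}(R)$. The operations $d$ and $e$ are $I_d=I$ and $I_e=K$ for all $I\in\overline{F}(R)$. Ideal valuation on $R$: a function $\nu:\mathcal{S}(R)\to\overline{\mathbb{N}}$ such that (IV1) $\nu(0)=0$ and $\nu(R)=\infty$; (IV2) $\min\{\nu(I),\nu(J)\}\le\nu(IJ)$ for all $I,J\in\mathcal{S}(R)$; (IV3) $\nu(I)=\sup\{\nu(J)\mid J\subseteq I,\ J\in f\mathcal{S}(R)\}$ for all $I\in\mathcal{S}(R)$. It is constant on proper ideals of $R$ if there is $c\in\overline{\mathbb{N}}$ with $\nu(I)=c$ for all $I\in\mathcal{S}'(R)$. Prime valuation on $R$: a function $h:\operatorname{Spec}(R)\to\overline{\mathbb{N}}$ with $h(0)=0$ and $h(P)\le h(Q)$ whenever $P\subseteq Q$. It is constant on nonzero prime ideals of $R$ if there is $d\in\overline{\mathbb{N}}$ with $h(P)=d$ for every nonzero prime ideal $P$ of $R$. *)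

theory Defs
  imports "HOL-Library.Extended_Nat" "HOL-Library.FuncSet" "HOL-Algebra.Ideal_Product" "HOL-Algebra.Module"
begin

section \<open>Integral domains and their quotient fields\<close>

text \<open>The domain is literally contained in its quotient field; its operations have to agree with
  those of the field on the carrier only.\<close>

definition quotient_field :: "('a, 'm) ring_scheme \<Rightarrow> ('a, 'n) ring_scheme \<Rightarrow> bool" where
  "quotient_field R K \<longleftrightarrow>
     domain R \<and> field K \<and> carrier R \<subseteq> carrier K \<and> id \<in> ring_hom R K \<and>
     (\<forall>x\<in>carrier K. \<exists>a\<in>carrier R. \<exists>b\<in>carrier R - {\<zero>\<^bsub>R\<^esub>}. x = a \<otimes>\<^bsub>K\<^esub> inv\<^bsub>K\<^esub> b)"

definition quasi_local_domain :: "('a, 'm) ring_scheme \<Rightarrow> bool" where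
  "quasi_local_domain R \<longleftrightarrow> domain R \<and> (\<exists>!M. maximalideal M R)"

definition Spec :: "('a, 'm) ring_scheme \<Rightarrow> 'a set set" where
  "Spec R = {P. primeideal P R}"

definition krull_dim :: "('a, 'm) ring_scheme \<Rightarrow> enat" where
  "krull_dim R =
     Sup {enat n | n. \<exists>P. (\<forall>i\<le>n. P i \<in> Spec R) \<and> (\<forall>i<n. P i \<subset> P (Suc i))}"

section \<open>Submodules of the quotient field\<close>

definition as_module :: "('a, 'n) ring_scheme \<Rightarrow> ('a, 'a) module" where
  "as_module K = \<lparr>carrier = carrier K, mult = mult K, one = \<one>\<^bsub>K\<^esub>, zero = \<zero>\<^bsub>K\<^esub>,
                  add = add K, smult = mult K\<rparr>"

definition Fbar :: "('a, 'm) ring_scheme \<Rightarrow> ('a, 'n) ring_scheme \<Rightarrow> 'a set set" where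
  "Fbar R K = {M. submodule M R (as_module K) \<and> M \<noteq> {\<zero>\<^bsub>K\<^esub>}}"

definition gen_submodule ::
  "('a, 'm) ring_scheme \<Rightarrow> ('a, 'n) ring_scheme \<Rightarrow> 'a set \<Rightarrow> 'a set" where
  "gen_submodule R K A = \<Inter>{M. submodule M R (as_module K) \<and> A \<subseteq> M}"

definition fg_Fbar :: "('a, 'm) ring_scheme \<Rightarrow> ('a, 'n) ring_scheme \<Rightarrow> 'a set set" where
  "fg_Fbar R K = {J \<in> Fbar R K. \<exists>A. finite A \<and> A \<subseteq> carrier K \<and> J = gen_submodule R K A}"

definition colon :: "('a, 'n) ring_scheme \<Rightarrow> 'a set \<Rightarrow> 'a set \<Rightarrow> 'a set" where
  "colon K I J = {x \<in> carrier K. x <#\<^bsub>K\<^esub> J \<subseteq> I}"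

section \<open>Semistar operations\<close>

text \<open>Self-maps of \<open>Fbar R K\<close> are represented by functions that are extensional, i.e. equal to
  \<open>undefined\<close> outside \<open>Fbar R K\<close>, so that equality of operations is HOL equality.\<close>

definition semistar ::
  "('a, 'm) ring_scheme \<Rightarrow> ('a, 'n) ring_scheme \<Rightarrow> ('a set \<Rightarrow> 'a set) \<Rightarrow> bool" where
  "semistar R K s \<longleftrightarrow>
     s \<in> Fbar R K \<rightarrow>\<^sub>E Fbar R K \<and>
     (\<forall>I\<in>Fbar R K. I \<subseteq> s I) \<and>
     (\<forall>I\<in>Fbar R K. \<forall>J\<in>Fbar R K. I \<subseteq> J \<longrightarrow> s I \<subseteq> s J) \<and>
     (\<forall>I\<in>Fbar R K. \<forall>x\<in>carrier K - {\<zero>\<^bsub>K\<^esub>}. s (x <#\<^bsub>K\<^esub> I) = x <#\<^bsub>K\<^esub> s I) \<and>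
     (\<forall>I\<in>Fbar R K. s (s I) = s I)"

definition stable_semistar ::
  "('a, 'm) ring_scheme \<Rightarrow> ('a, 'n) ring_scheme \<Rightarrow> ('a set \<Rightarrow> 'a set) \<Rightarrow> bool" where
  "stable_semistar R K s \<longleftrightarrow> (\<forall>I\<in>Fbar R K. \<forall>J\<in>Fbar R K. s (I \<inter> J) = s I \<inter> s J)"

definition semistar_f ::
  "('a, 'm) ring_scheme \<Rightarrow> ('a, 'n) ring_scheme \<Rightarrow> ('a set \<Rightarrow> 'a set) \<Rightarrow> 'a set \<Rightarrow> 'a set" where
  "semistar_f R K s = (\<lambda>I\<in>Fbar R K. \<Union>{s J | J. J \<in> fg_Fbar R K \<and> J \<subseteq> I})"

definition finite_type ::
  "('a, 'm) ring_scheme \<Rightarrow> ('a, 'n) ring_scheme \<Rightarrow> ('a set \<Rightarrow> 'a set) \<Rightarrow> bool" where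
  "finite_type R K s \<longleftrightarrow> s = semistar_f R K s"

definition semistar_tilde ::
  "('a, 'm) ring_scheme \<Rightarrow> ('a, 'n) ring_scheme \<Rightarrow> ('a set \<Rightarrow> 'a set) \<Rightarrow> 'a set \<Rightarrow> 'a set" where
  "semistar_tilde R K s =
     (\<lambda>I\<in>Fbar R K. \<Union>{colon K I J | J. ideal J R \<and> J \<noteq> {\<zero>\<^bsub>R\<^esub>} \<and> semistar_f R K s J = s (carrier R)})"

definition semistar_d ::
  "('a, 'm) ring_scheme \<Rightarrow> ('a, 'n) ring_scheme \<Rightarrow> 'a set \<Rightarrow> 'a set" where
  "semistar_d R K = (\<lambda>I\<in>Fbar R K. I)"

definition semistar_e ::
  "('a, 'm) ring_scheme \<Rightarrow> ('a, 'n) ring_scheme \<Rightarrow> 'a set \<Rightarrow> 'a set" where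
  "semistar_e R K = (\<lambda>I\<in>Fbar R K. carrier K)"

section \<open>Ideal valuations and prime valuations\<close>

text \<open>Only the values on ideals, respectively on prime ideals, are relevant.\<close>

definition fg_ideal :: "('a, 'm) ring_scheme \<Rightarrow> 'a set \<Rightarrow> bool" where
  "fg_ideal R J \<longleftrightarrow> (\<exists>A. finite A \<and> A \<subseteq> carrier R \<and> J = Idl\<^bsub>R\<^esub> A)"

definition ideal_valuation :: "('a, 'm) ring_scheme \<Rightarrow> ('a set \<Rightarrow> enat) \<Rightarrow> bool" where
  "ideal_valuation R v \<longleftrightarrow>
     v {\<zero>\<^bsub>R\<^esub>} = 0 \<and> v (carrier R) = \<infinity> \<and>
     (\<forall>I J. ideal I R \<and> ideal J R \<longrightarrow> min (v I) (v J) \<le> v (I \<cdot>\<^bsub>R\<^esub> J)) \<and>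
     (\<forall>I. ideal I R \<longrightarrow> v I = Sup {v J | J. J \<subseteq> I \<and> fg_ideal R J})"

definition constant_on_proper_ideals :: "('a, 'm) ring_scheme \<Rightarrow> ('a set \<Rightarrow> enat) \<Rightarrow> bool" where
  "constant_on_proper_ideals R v \<longleftrightarrow>
     (\<exists>c. \<forall>I. ideal I R \<and> I \<noteq> {\<zero>\<^bsub>R\<^esub>} \<and> I \<noteq> carrier R \<longrightarrow> v I = c)"

definition prime_valuation :: "('a, 'm) ring_scheme \<Rightarrow> ('a set \<Rightarrow> enat) \<Rightarrow> bool" where
  "prime_valuation R h \<longleftrightarrow>
     h {\<zero>\<^bsub>R\<^esub>} = 0 \<and> (\<forall>P\<in>Spec R. \<forall>Q\<in>Spec R. P \<subseteq> Q \<longrightarrow> h P \<le> h Q)"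

definition constant_on_nonzero_primes :: "('a, 'm) ring_scheme \<Rightarrow> ('a set \<Rightarrow> enat) \<Rightarrow> bool" where
  "constant_on_nonzero_primes R h \<longleftrightarrow> (\<exists>d. \<forall>P\<in>Spec R. P \<noteq> {\<zero>\<^bsub>R\<^esub>} \<longrightarrow> h P = d)"

end

theory Submission
  imports Defs "HOL-Algebra.Ring_Divisibility"
begin

text \<open>All five conditions say that there is exactly one nonzero prime ideal. If there is one, then
  every nonzero ideal contains a power of any given finitely generated proper ideal. So a family of
  ideals that is closed under products and larger ideals, and that contains a finitely generated
  proper ideal, contains all nonzero ideals. Applied to \<open>{B. \<nu>(A) \<le> \<nu>(B)}\<close> this shows that \<open>\<nu>\<close> is
  constant; applied to \<open>{B. 1 \<in> B\<^sup>*}\<close> it shows that \<open>* \<noteq> e\<close> leaves only \<open>J = R\<close> in the definition of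
  the tilde operation. Conversely, a nonzero prime \<open>P\<close> is tested with the ideal valuation that
  vanishes exactly inside \<open>P\<close>, with the prime valuation that indicates the primes above \<open>P\<close>, and with
  the localization \<open>I \<mapsto> I R\<^sub>P\<close>, which is stable and of finite type.\<close>

section \<open>Domains with a unique nonzero prime ideal\<close>

lemma (in cring) ideal_mult_preimage:
  assumes "ideal I R" "a \<in> carrier R"
  shows "ideal {x \<in> carrier R. a \<otimes> x \<in> I} R"
  using ideal.helper_max_prime[OF assms(1) is_cring assms(2)] .

text \<open>For fixed \<open>y\<close>, the elements that \<open>y\<close> multiplies into
  \<open>Z\<close> form an ideal. Minimality of \<open>Idl X\<close> and then of
  \<open>Idl Y\<close> against such ideals carries the containment from generators to all
  elements.\<close>

lemma (in cring) genideal_prod_subset: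
  assumes "X \<subseteq> carrier R" "Y \<subseteq> carrier R" "ideal Z R"
    and XY: "\<And>x y. \<lbrakk>x \<in> X; y \<in> Y\<rbrakk> \<Longrightarrow> x \<otimes> y \<in> Z"
  shows "(Idl X) \<cdot> (Idl Y) \<subseteq> Z"
proof -
  interpret Z: ideal Z R by fact
  have carr: "Idl X \<subseteq> carrier R" "Idl Y \<subseteq> carrier R"
    using assms(1,2) genideal_minimal oneideal by auto
  have 1: "x \<otimes> y \<in> Z" if "x \<in> Idl X" "y \<in> Y" for x y
  proof -
    have "X \<subseteq> {x \<in> carrier R. y \<otimes> x \<in> Z}"
      using assms(1,2) XY that(2) m_comm by (auto simp: subset_iff)
    then have "Idl X \<subseteq> {x \<in> carrier R. y \<otimes> x \<in> Z}"
      using that(2) assms(2,3) by (intro genideal_minimal ideal_mult_preimage) auto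
    then show ?thesis using that assms(2) m_comm by (auto simp: subset_iff)
  qed
  have 2: "x \<otimes> y \<in> Z" if "x \<in> Idl X" "y \<in> Idl Y" for x y
  proof -
    have "Idl Y \<subseteq> {y \<in> carrier R. x \<otimes> y \<in> Z}"
      using 1[OF that(1)] assms(2,3) that(1) carr
      by (intro genideal_minimal ideal_mult_preimage) auto
    then show ?thesis using that by auto
  qed
  show ?thesis
  proof
    fix z assume "z \<in> (Idl X) \<cdot> (Idl Y)"
    then show "z \<in> Z" by induction (auto intro: 2)
  qed
qed

text \<open>By Zorn there is an ideal \<open>P\<close> maximal among those that contain
  \<open>J\<close> and miss \<open>S\<close>. Adjoining an element outside \<open>P\<close> brings
  in an element of \<open>S\<close>; if two outside elements had their product in \<open>P\<close>,
  so would the two elements of \<open>S\<close> obtained in this way.\<close>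

lemma (in cring) exists_primeideal_disjoint:
  assumes J: "ideal J R" and S: "\<one> \<in> S" "S \<subseteq> carrier R"
    and S_mult: "\<And>s t. \<lbrakk>s \<in> S; t \<in> S\<rbrakk> \<Longrightarrow> s \<otimes> t \<in> S"
    and disj: "J \<inter> S = {}"
  obtains P where "primeideal P R" "J \<subseteq> P" "P \<inter> S = {}"
proof -
  define A where "A = {I. ideal I R \<and> J \<subseteq> I \<and> I \<inter> S = {}}"
  have "\<exists>P\<in>A. \<forall>X\<in>A. P \<subseteq> X \<longrightarrow> X = P"
  proof (rule subset_Zorn_nonempty)
    show "A \<noteq> {}" using J disj by (auto simp: A_def)
    fix C assume C: "C \<noteq> {}" "subset.chain A C"
    then have CA: "C \<subseteq> A" by (simp add: subset_chain_def)
    have "subset.chain {I. ideal I R} C"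
      using C(2) by (auto simp: subset_chain_def A_def)
    with C(1) have "ideal (\<Union>C) R" using chain_Union_is_ideal[of C] by simp
    with C(1) CA show "\<Union>C \<in> A" by (fastforce simp: A_def)
  qed
  then obtain P where P: "ideal P R" "J \<subseteq> P" "P \<inter> S = {}"
    and P_max: "\<And>X. \<lbrakk>ideal X R; P \<subseteq> X; X \<inter> S = {}\<rbrakk> \<Longrightarrow> X = P"
    unfolding A_def by auto
  interpret P: ideal P R by (rule P)
  have grow: "\<exists>s\<in>S. s \<in> Idl (insert x P)" if "x \<in> carrier R" "x \<notin> P" for x
  proof (rule ccontr)
    assume no: "\<not> ?thesis"
    have sub: "insert x P \<subseteq> Idl (insert x P)"
      using that(1) P.Icarr by (intro genideal_self) auto
    have "Idl (insert x P) = P"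
      using that(1) P.Icarr no sub by (intro P_max genideal_ideal) auto
    then show False using sub that(2) by auto
  qed
  have "primeideal P R"
  proof (rule primeidealI[OF P(1) is_cring])
    show "carrier R \<noteq> P" using S P(3) by auto
    fix x y assume xy: "x \<in> carrier R" "y \<in> carrier R" "x \<otimes> y \<in> P"
    show "x \<in> P \<or> y \<in> P"
    proof (rule ccontr)
      assume "\<not> ?thesis"
      then obtain s t where st: "s \<in> S" "s \<in> Idl (insert x P)" "t \<in> S" "t \<in> Idl (insert y P)"
        using grow xy by blast
      have "(Idl (insert x P)) \<cdot> (Idl (insert y P)) \<subseteq> P"
        using xy P.Icarr P.I_l_closed P.I_r_closed
        by (intro genideal_prod_subset P(1)) auto
      then have "s \<otimes> t \<in> P" using ideal_prod.prod[OF st(2,4), of R] by (rule subsetD)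
      then show False using S_mult[OF st(1,3)] P(3) by auto
    qed
  qed
  with P that show thesis by blast
qed

lemma (in cring) exists_primeideal_containing:
  assumes "ideal J R" "J \<noteq> carrier R"
  obtains P where "primeideal P R" "J \<subseteq> P"
proof -
  have "\<one> \<notin> J" using assms ideal.one_imp_carrier by blast
  then show thesis
    using exists_primeideal_disjoint[OF assms(1), of "{\<one>}"] that by auto
qed

text \<open>A downward walk from \<open>J + (A)\<close> to \<open>J\<close> that drops one generator \<open>a\<close> at a time, through
  \<open>(J + (a)) (J + (a\<^sup>n)) \<subseteq> J + (a\<^sup>n\<^sup>+\<^sup>1)\<close>; this replaces the powers of finitely generated ideals.\<close>

lemma (in cring) ideal_family_descent:
  assumes F_ideal: "\<And>I. F I \<Longrightarrow> ideal I R"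
    and F_mono: "\<And>I J. \<lbrakk>F I; I \<subseteq> J; ideal J R\<rbrakk> \<Longrightarrow> F J"
    and F_prod: "\<And>I J. \<lbrakk>F I; F J\<rbrakk> \<Longrightarrow> F (I \<cdot> J)"
    and "finite A" "A \<subseteq> carrier R" "ideal J R"
    and "\<And>a. a \<in> A \<Longrightarrow> \<exists>n. a [^] (n::nat) \<in> J"
    and "F (Idl (J \<union> A))"
  shows "F J"
  using assms(4-)
proof (induction A arbitrary: J rule: finite_induct)
  case empty
  then show ?case using genideal_minimal[of J J] F_mono by auto
next
  case (insert a A)
  interpret J: ideal J R by (rule insert.prems)
  have a: "a \<in> carrier R" using insert.prems by auto
  have gen_ideal: "ideal (Idl (insert x J)) R" and gen_self: "insert x J \<subseteq> Idl (insert x J)"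
    if "x \<in> carrier R" for x
    using that J.Icarr genideal_ideal[of "insert x J"] genideal_self[of "insert x J"]
    by (auto simp: subset_iff)
  \<comment> \<open>The induction hypothesis is applied to the larger ideal
    \<open>Idl (insert a J)\<close>, above which only the generators in \<open>A\<close>
    remain.\<close>
  have "F (Idl (insert a J))"
  proof (rule insert.IH)
    show "A \<subseteq> carrier R" using insert.prems by auto
    show "ideal (Idl (insert a J)) R" using gen_ideal a .
    show "\<exists>n::nat. b [^] n \<in> Idl (insert a J)" if "b \<in> A" for b
      using that insert.prems(3)[of b] gen_self[OF a] by auto
    have "J \<union> insert a A \<subseteq> Idl (insert a J) \<union> A" using gen_self[OF a] by auto
    moreover have "Idl (insert a J) \<union> A \<subseteq> carrier R"
      using insert.prems ideal.Icarr[OF gen_ideal[OF a]] by auto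
    ultimately show "F (Idl (Idl (insert a J) \<union> A))"
      by (intro F_mono[OF insert.prems(4)] genideal_ideal subset_Idl_subset)
  qed
  have pow: "F (Idl (insert (a [^] Suc n) J))" for n
  proof (induction n)
    case 0
    then show ?case using \<open>F (Idl (insert a J))\<close> a by simp
  next
    case (Suc n)
    let ?Z = "Idl (insert (a [^] Suc (Suc n)) J)"
    interpret Z: ideal ?Z R using gen_ideal a by simp
    have JZ: "J \<subseteq> ?Z" and aZ: "a [^] Suc (Suc n) \<in> ?Z"
      using gen_self[of "a [^] Suc (Suc n)"] a by auto
    have "a \<otimes> a [^] Suc n \<in> ?Z" using aZ a m_comm by (metis nat_pow_Suc nat_pow_closed)
    then have "(Idl (insert a J)) \<cdot> (Idl (insert (a [^] Suc n) J)) \<subseteq> ?Z"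
      using a J.Icarr JZ J.I_l_closed J.I_r_closed
      by (intro genideal_prod_subset Z.is_ideal) (auto simp del: nat_pow_Suc)
    then show ?case using F_mono F_prod[OF \<open>F (Idl (insert a J))\<close> Suc] Z.is_ideal by blast
  qed
  obtain n :: nat where n: "a [^] n \<in> J" using insert.prems by auto
  then have "a [^] Suc n \<in> J" using a J.I_r_closed by simp
  then have "insert (a [^] Suc n) J = J" by auto
  moreover have "Idl J = J"
    using genideal_minimal[of J J] genideal_self[of J] J.is_ideal J.Icarr by blast
  ultimately show ?case using pow[of n] by simp
qed

text \<open>Every \<open>a\<close> in \<open>A\<close> has a power in \<open>J\<close>: otherwise
  some prime contains \<open>J\<close> and misses all powers of \<open>a\<close>, while another
  contains \<open>Idl A\<close> and hence \<open>a\<close>; both are nonzero, against uniqueness. So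
  the descent from \<open>Idl (J \<union> A)\<close> reaches \<open>J\<close>.\<close>

lemma (in domain) ideal_family_top_or_all:
  assumes unique: "\<exists>!P. primeideal P R \<and> P \<noteq> {\<zero>}"
    and F_ideal: "\<And>I. F I \<Longrightarrow> ideal I R"
    and F_mono: "\<And>I J. \<lbrakk>F I; I \<subseteq> J; ideal J R\<rbrakk> \<Longrightarrow> F J"
    and F_prod: "\<And>I J. \<lbrakk>F I; F J\<rbrakk> \<Longrightarrow> F (I \<cdot> J)"
    and A: "finite A" "A \<subseteq> carrier R" "F (Idl A)" "Idl A \<noteq> carrier R"
    and J: "ideal J R" "J \<noteq> {\<zero>}"
  shows "F J"
proof (rule ideal_family_descent[where F = F])
  interpret J: ideal J R by (rule J)
  have IA: "ideal (Idl A) R" using A genideal_ideal by auto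
  have "J \<union> A \<subseteq> carrier R" using J.Icarr A by auto
  then show "F (Idl (J \<union> A))"
    using F_mono[OF A(3)] genideal_ideal subset_Idl_subset[of "J \<union> A" A] by auto
  fix a assume a: "a \<in> A"
  show "\<exists>n::nat. a [^] n \<in> J"
  proof (rule ccontr)
    assume no: "\<not> ?thesis"
    have "a \<in> carrier R" using a A by auto
    define S where "S = range (\<lambda>n::nat. a [^] n)"
    have "\<one> \<in> S" unfolding S_def by (metis nat_pow_0 rangeI)
    moreover have "S \<subseteq> carrier R" using \<open>a \<in> carrier R\<close> by (auto simp: S_def)
    moreover have "s \<otimes> t \<in> S" if "s \<in> S" "t \<in> S" for s t
      using that \<open>a \<in> carrier R\<close> by (auto simp: S_def nat_pow_mult)
    moreover have "J \<inter> S = {}" using no by (auto simp: S_def)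
    ultimately obtain P where P: "primeideal P R" "J \<subseteq> P" "P \<inter> S = {}"
      using exists_primeideal_disjoint[OF J(1)] by blast
    have "a \<in> S" unfolding S_def using \<open>a \<in> carrier R\<close> by (metis nat_pow_eone rangeI)
    then have "a \<notin> P" using P(3) by auto
    obtain Q where Q: "primeideal Q R" "Idl A \<subseteq> Q"
      using exists_primeideal_containing IA A(4) by blast
    have "a \<in> Q" using Q(2) genideal_self[OF A(2)] a by auto
    \<comment> \<open>Since \<open>\<zero>\<close> lies in \<open>P\<close> and \<open>a\<close>
      does not, the zero generator is excluded, which makes \<open>Q\<close> nonzero.\<close>
    have "a \<noteq> \<zero>" using P(1) \<open>a \<notin> P\<close> by (metis additive_subgroup.zero_closed ideal.axioms(1) primeideal.axioms(1))
    have "P \<noteq> {\<zero>}" using P(2) J(2) J.zero_closed by auto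
    moreover have "Q \<noteq> {\<zero>}" using \<open>a \<in> Q\<close> \<open>a \<noteq> \<zero>\<close> by auto
    ultimately have "P = Q" using unique P Q by auto
    then show False using \<open>a \<in> Q\<close> \<open>a \<notin> P\<close> by auto
  qed
qed (fact assms)+

section \<open>Dimension one and quasi-locality in terms of primes\<close>

lemma (in domain) exists_nonzero_primeideal:
  assumes "\<not> field R"
  obtains P where "primeideal P R" "P \<noteq> {\<zero>}"
proof -
  obtain I where I: "ideal I R" "I \<noteq> {\<zero>}" "I \<noteq> carrier R"
  proof -
    have "{I. ideal I R} \<noteq> {{\<zero>}, carrier R}"
      using assms trivialideals_eq_field carrier_one_not_zero by auto
    then show thesis using that zeroideal oneideal by blast
  qed
  obtain P where P: "primeideal P R" "I \<subseteq> P"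
    using exists_primeideal_containing I by blast
  have "\<zero> \<in> I" using I by (simp add: additive_subgroup.zero_closed ideal.axioms(1))
  then have "P \<noteq> {\<zero>}" using I P by blast
  then show thesis using P that by blast
qed

text \<open>Dimension one forbids a chain \<open>{\<zero>} \<subset> P \<subset> Q\<close>, so
  nonzero primes are maximal and quasi-locality leaves only one. Conversely, a sole nonzero prime is
  maximal, equals every maximal ideal because \<open>R\<close> is not a field, and allows chains
  with at most one inclusion.\<close>

lemma (in domain) one_dim_quasi_local_iff:
  assumes "\<not> field R"
  shows "quasi_local_domain R \<and> krull_dim R = 1 \<longleftrightarrow> (\<exists>!P. primeideal P R \<and> P \<noteq> {\<zero>})"
    (is "?lhs \<longleftrightarrow> ?rhs")
proof
  have nz: "\<zero> \<in> P" if "primeideal P R" for P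
    using that by (simp add: additive_subgroup.zero_closed ideal.axioms(1) primeideal.axioms(1))
  \<comment> \<open>Every proper ideal lies in a prime, so a prime with no larger prime above it is
    maximal among all proper ideals.\<close>
  have max: "maximalideal P R"
    if P: "primeideal P R" "P \<noteq> {\<zero>}"
      and no: "\<And>Q. \<lbrakk>primeideal Q R; P \<subseteq> Q\<rbrakk> \<Longrightarrow> Q = P" for P
  proof (rule maximalidealI)
    show "ideal P R" "carrier R \<noteq> P" using P(1) primeideal.I_notcarr by (auto intro: primeideal.axioms(1))
    fix J assume J: "ideal J R" "P \<subseteq> J" "J \<subseteq> carrier R"
    show "J = P \<or> J = carrier R"
    proof (rule disjCI)
      assume "J \<noteq> carrier R"
      then obtain Q where "primeideal Q R" "J \<subseteq> Q"
        using exists_primeideal_containing J by blast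
      then show "J = P" using no[of Q] J by auto
    qed
  qed
  show ?rhs if lhs: ?lhs
  proof -
    have no: "Q = P" if PQ: "primeideal P R" "P \<noteq> {\<zero>}" "primeideal Q R" "P \<subseteq> Q" for P Q
    proof (rule ccontr)
      assume "Q \<noteq> P"
      define C where "C = (\<lambda>i::nat. if i = 0 then {\<zero>} else if i = 1 then P else Q)"
      have "(\<forall>i\<le>2. C i \<in> Spec R) \<and> (\<forall>i<2. C i \<subset> C (Suc i))"
        using PQ \<open>Q \<noteq> P\<close> zeroprimeideal nz by (auto simp: C_def Spec_def less_2_cases_iff)
      then have "enat 2 \<le> krull_dim R" unfolding krull_dim_def by (intro Sup_upper) blast
      then show False using lhs by (simp add: one_enat_def)
    qed
    have max': "maximalideal P R" if "primeideal P R" "P \<noteq> {\<zero>}" for P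
      by (rule max[OF that no[OF that]])
    obtain P where P: "primeideal P R" "P \<noteq> {\<zero>}" using exists_nonzero_primeideal assms by blast
    show ?rhs
    proof (rule ex1I[of _ P])
      fix Q assume "primeideal Q R \<and> Q \<noteq> {\<zero>}"
      then have "maximalideal Q R" using max' by simp
      moreover have "maximalideal P R" using P max' by simp
      ultimately show "Q = P" using lhs unfolding quasi_local_domain_def by auto
    qed (use P in auto)
  qed
  show ?lhs if rhs: ?rhs
  proof -
    from rhs obtain M where M: "primeideal M R" "M \<noteq> {\<zero>}"
      and M_unique: "\<And>Q. \<lbrakk>primeideal Q R; Q \<noteq> {\<zero>}\<rbrakk> \<Longrightarrow> Q = M" by auto
    have "maximalideal M R"
    proof (rule max[OF M])
      fix Q assume "primeideal Q R" "M \<subseteq> Q"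
      then show "Q = M" using M_unique[of Q] M nz[OF M(1)] by blast
    qed
    moreover have "N = M" if "maximalideal N R" for N
      using that M_unique[of N] maximalideal_prime zeromaximalideal_eq_field assms by auto
    ultimately have "\<exists>!N. maximalideal N R" by (rule ex1I)
    then have ql: "quasi_local_domain R"
      unfolding quasi_local_domain_def using domain_axioms by (rule conjI[rotated])
    have "krull_dim R \<le> 1"
      unfolding krull_dim_def
    proof (rule Sup_least, clarify, rule ccontr)
      fix n C assume C: "\<forall>i\<le>n. C i \<in> Spec R" "\<forall>i<n. C i \<subset> C (Suc i)" and "\<not> enat n \<le> 1"
      then have n: "2 \<le> n" by (simp add: one_enat_def)
      then have pr: "primeideal (C 0) R" "primeideal (C 1) R" "primeideal (C 2) R"
        and sub: "C 0 \<subset> C 1" "C 1 \<subset> C 2"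
        using C(1) C(2)[rule_format, of 0] C(2)[rule_format, of 1]
        by (auto simp: Spec_def numeral_2_eq_2)
      have "\<zero> \<in> C 0" using nz pr by simp
      then have "C 1 \<noteq> {\<zero>}" "C 2 \<noteq> {\<zero>}" using sub by auto
      then have "C 1 = C 2" using M_unique[of "C 1"] M_unique[of "C 2"] pr by simp
      then show False using sub by simp
    qed
    moreover have "1 \<le> krull_dim R"
      unfolding krull_dim_def one_enat_def
    proof (rule Sup_upper, clarify, intro exI conjI)
      let ?C = "\<lambda>i::nat. if i = 0 then {\<zero>} else M"
      show "\<forall>i\<le>1. ?C i \<in> Spec R" using M zeroprimeideal by (auto simp: Spec_def)
      show "\<forall>i<1. ?C i \<subset> ?C (Suc i)" using M nz by auto
    qed simp
    ultimately show ?lhs using ql by auto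
  qed
qed

section \<open>Valuations\<close>

text \<open>The supremum that gives \<open>v J\<close> also ranges over the finitely generated
  ideals inside \<open>I\<close>.\<close>

lemma (in ring) ideal_valuation_mono:
  assumes "ideal_valuation R v" "ideal I R" "ideal J R" "I \<subseteq> J"
  shows "v I \<le> v J"
proof -
  have "v I = Sup {v A |A. A \<subseteq> I \<and> fg_ideal R A}" "v J = Sup {v A |A. A \<subseteq> J \<and> fg_ideal R A}"
    using assms(1-3) by (auto simp: ideal_valuation_def)
  then show ?thesis using assms(4) by (auto intro!: Sup_subset_mono)
qed

text \<open>The value of a proper ideal is at most that of any nonzero ideal, so two proper nonzero
  ideals bound each other. The supremum axiom replaces the proper ideal by its finitely generated
  subideals, from which the descent can start.\<close>

lemma (in domain) ideal_valuation_constant: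
  assumes unique: "\<exists>!P. primeideal P R \<and> P \<noteq> {\<zero>}" and v: "ideal_valuation R v"
  shows "constant_on_proper_ideals R v"
proof -
  have le: "v I \<le> v J"
    if I: "ideal I R" "I \<noteq> carrier R" and J: "ideal J R" "J \<noteq> {\<zero>}" for I J
  proof -
    have fg: "v (Idl A) \<le> v J" if A: "finite A" "A \<subseteq> carrier R" "Idl A \<subseteq> I" for A
    proof -
      \<comment> \<open>A product has at least the smaller of the two values, so staying above the
        fixed threshold \<open>v (Idl A)\<close> survives products.\<close>
      define F where "F = (\<lambda>B. ideal B R \<and> v (Idl A) \<le> v B)"
      have "F J"
      proof (rule ideal_family_top_or_all[OF unique _ _ _ A(1,2) _ _ J])
        show "F C" if "F B" "B \<subseteq> C" "ideal C R" for B C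
          using that ideal_valuation_mono[OF v, of B C] by (auto simp: F_def)
        show "F (B \<cdot> C)" if "F B" "F C" for B C
        proof -
          have "min (v B) (v C) \<le> v (B \<cdot> C)" using v that by (auto simp: ideal_valuation_def F_def)
          then show ?thesis using that ideal_prod_is_ideal
            by (auto simp: F_def min_def split: if_splits)
        qed
        show "F (Idl A)" using A genideal_ideal by (auto simp: F_def)
        show "Idl A \<noteq> carrier R" using A I ideal.Icarr[OF I(1)] by blast
      qed (simp add: F_def)
      then show ?thesis by (simp add: F_def)
    qed
    have "v I = Sup {v A |A. A \<subseteq> I \<and> fg_ideal R A}"
      using v I by (auto simp: ideal_valuation_def)
    also have "\<dots> \<le> v J" by (rule Sup_least) (auto simp: fg_ideal_def intro: fg)
    finally show ?thesis .
  qed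
  show ?thesis
  proof (cases "\<exists>I. ideal I R \<and> I \<noteq> {\<zero>} \<and> I \<noteq> carrier R")
    case True
    then obtain I where "ideal I R" "I \<noteq> {\<zero>}" "I \<noteq> carrier R" by blast
    then show ?thesis unfolding constant_on_proper_ideals_def
      using le by (meson order_antisym)
  qed (auto simp: constant_on_proper_ideals_def)
qed

text \<open>Primality yields the product axiom: two ideals not inside \<open>P\<close> have a
  product not inside \<open>P\<close>. For the supremum axiom, one element outside \<open>P\<close>
  already generates a principal ideal of value \<open>\<infinity>\<close>.\<close>

lemma (in domain) ideal_valuation_of_prime:
  assumes P: "primeideal P R"
  shows "ideal_valuation R (\<lambda>I. if I \<subseteq> P then 0 else \<infinity>)"
proof -
  interpret P: primeideal P R by (rule P)
  have "\<not> I \<cdot> J \<subseteq> P" if IJ: "ideal I R" "ideal J R" "\<not> I \<subseteq> P" "\<not> J \<subseteq> P" for I J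
  proof -
    obtain x y where xy: "x \<in> I" "x \<notin> P" "y \<in> J" "y \<notin> P" using IJ by auto
    have "x \<otimes> y \<in> I \<cdot> J" by (rule ideal_prod.prod[OF xy(1,3)])
    moreover have "x \<otimes> y \<notin> P"
      using P.I_prime[OF ideal.Icarr[OF IJ(1) xy(1)] ideal.Icarr[OF IJ(2) xy(3)]] xy by blast
    ultimately show ?thesis by blast
  qed
  moreover have "Sup {if J \<subseteq> P then 0 else \<infinity> |J. J \<subseteq> I \<and> fg_ideal R J} = (\<infinity>::enat)"
    if I: "ideal I R" "\<not> I \<subseteq> P" for I
  proof -
    obtain x where x: "x \<in> I" "x \<notin> P" using I by auto
    have xR: "x \<in> carrier R" using x I ideal.Icarr by metis
    have "x \<in> Idl {x}" using xR genideal_self[of "{x}"] by auto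
    then have "\<not> Idl {x} \<subseteq> P" using x(2) by auto
    moreover have "Idl {x} \<subseteq> I" using x(1) I(1) by (intro genideal_minimal) auto
    moreover have "fg_ideal R (Idl {x})" unfolding fg_ideal_def using xR by (intro exI[of _ "{x}"]) auto
    ultimately have "(\<infinity>::enat) \<in> {if J \<subseteq> P then 0 else \<infinity> |J. J \<subseteq> I \<and> fg_ideal R J}"
      by (intro CollectI exI[of _ "Idl {x}"]) auto
    then have "(\<infinity>::enat) \<le> Sup {if J \<subseteq> P then 0 else \<infinity> |J. J \<subseteq> I \<and> fg_ideal R J}"
      by (rule Sup_upper)
    then show ?thesis by simp
  qed
  moreover have "Sup {if J \<subseteq> P then 0 else \<infinity> |J. J \<subseteq> I \<and> fg_ideal R J} = (0::enat)"
    if "I \<subseteq> P" for I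
  proof -
    have "Sup {if J \<subseteq> P then 0 else \<infinity> |J. J \<subseteq> I \<and> fg_ideal R J} \<le> (0::enat)"
      by (rule Sup_least) (use that in auto)
    then show ?thesis by simp
  qed
  moreover have "\<not> carrier R \<subseteq> P" using P.I_notcarr P.Icarr by auto
  moreover have "{\<zero>} \<subseteq> P" using P.zero_closed by auto
  ultimately show ?thesis
    unfolding ideal_valuation_def by auto
qed

text \<open>\<open>P\<close> has value \<open>0\<close> under its own valuation, so the constant is
  \<open>0\<close>, which puts every nonzero prime inside \<open>P\<close>; exchanging the roles
  gives equality.\<close>

lemma (in domain) unique_primeI_ideal_valuations:
  assumes "\<not> field R" and const: "\<And>v. ideal_valuation R v \<Longrightarrow> constant_on_proper_ideals R v"
  shows "\<exists>!P. primeideal P R \<and> P \<noteq> {\<zero>}"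
proof -
  have sub: "Q \<subseteq> P"
    if P: "primeideal P R" "P \<noteq> {\<zero>}" and Q: "primeideal Q R" "Q \<noteq> {\<zero>}" for P Q
  proof -
    obtain c where c: "\<And>I. \<lbrakk>ideal I R; I \<noteq> {\<zero>}; I \<noteq> carrier R\<rbrakk>
        \<Longrightarrow> (if I \<subseteq> P then 0 else \<infinity>) = (c::enat)"
      using const[OF ideal_valuation_of_prime[OF P(1)]]
      unfolding constant_on_proper_ideals_def by blast
    have "ideal P R" "P \<noteq> carrier R" "ideal Q R" "Q \<noteq> carrier R"
      using P Q primeideal.axioms(1) primeideal.I_notcarr by metis+
    then show ?thesis using c[of P] c[of Q] P Q by (auto split: if_splits)
  qed
  obtain P where P: "primeideal P R" "P \<noteq> {\<zero>}"
    using exists_nonzero_primeideal[OF assms(1)] .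
  show ?thesis
  proof (rule ex1I[of _ P])
    fix Q assume "primeideal Q R \<and> Q \<noteq> {\<zero>}"
    then show "Q = P" using sub[of P Q] sub[of Q P] P by simp
  qed (use P in simp)
qed

text \<open>The indicator of the primes above \<open>P\<close> is \<open>1\<close> at
  \<open>P\<close>, so constancy puts every nonzero prime above \<open>P\<close>; exchanging the
  roles gives equality.\<close>

lemma (in domain) unique_primeI_prime_valuations:
  assumes "\<not> field R" and const: "\<And>h. prime_valuation R h \<Longrightarrow> constant_on_nonzero_primes R h"
  shows "\<exists>!P. primeideal P R \<and> P \<noteq> {\<zero>}"
proof -
  have sub: "P \<subseteq> Q"
    if P: "primeideal P R" "P \<noteq> {\<zero>}" and Q: "primeideal Q R" "Q \<noteq> {\<zero>}" for P Q
  proof -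
    \<comment> \<open>Hence the nonzero \<open>P\<close> is not contained in the zero ideal, and the
      indicator vanishes there as required.\<close>
    have "\<zero> \<in> P" using P by (simp add: additive_subgroup.zero_closed ideal.axioms(1) primeideal.axioms(1))
    then have "prime_valuation R (\<lambda>X. if P \<subseteq> X then 1 else 0)"
      using P by (auto simp: prime_valuation_def)
    from const[OF this] obtain d
      where "\<forall>X\<in>Spec R. X \<noteq> {\<zero>} \<longrightarrow> (if P \<subseteq> X then 1 else 0) = (d::enat)"
      unfolding constant_on_nonzero_primes_def by (elim exE)
    then have "(if P \<subseteq> P then 1 else 0) = d" "(if P \<subseteq> Q then 1 else 0) = d"
      using P Q unfolding Spec_def by blast+
    then show ?thesis by (auto split: if_splits)
  qed
  obtain P where P: "primeideal P R" "P \<noteq> {\<zero>}"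
    using exists_nonzero_primeideal[OF assms(1)] .
  show ?thesis
  proof (rule ex1I[of _ P])
    fix Q assume "primeideal Q R \<and> Q \<noteq> {\<zero>}"
    then show "Q = P" using sub[of P Q] sub[of Q P] P by simp
  qed (use P in simp)
qed

section \<open>Submodules of the quotient field\<close>

text \<open>\<open>K\<close> is the default structure, so plain operations are those of the field;
  on elements of \<open>R\<close> the operations of \<open>R\<close> are rewritten to them.\<close>

locale domain_with_quotient_field = K?: field K + R: domain R
  for K :: "('a, 'n) ring_scheme" (structure) and R :: "('a, 'm) ring_scheme" +
  assumes quotient_field: "quotient_field R K"
begin

section \<open>Compatibility of the domain with its quotient field\<close>

lemma carrier_subset: "x \<in> carrier R \<Longrightarrow> x \<in> carrier K"
  using quotient_field unfolding quotient_field_def by blast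

lemma mult_R: "\<lbrakk>x \<in> carrier R; y \<in> carrier R\<rbrakk> \<Longrightarrow> x \<otimes>\<^bsub>R\<^esub> y = x \<otimes> y"
  using quotient_field ring_hom_mult[of id R K x y] unfolding quotient_field_def by simp

lemma add_R: "\<lbrakk>x \<in> carrier R; y \<in> carrier R\<rbrakk> \<Longrightarrow> x \<oplus>\<^bsub>R\<^esub> y = x \<oplus> y"
  using quotient_field ring_hom_add[of id R K x y] unfolding quotient_field_def by simp

lemma one_R [simp]: "\<one>\<^bsub>R\<^esub> = \<one>"
  using quotient_field ring_hom_one[of id R K] unfolding quotient_field_def by simp

lemma zero_R [simp]: "\<zero>\<^bsub>R\<^esub> = \<zero>"
  using quotient_field ring_hom_zero[of id R K] R.ring_axioms K.ring_axioms
  unfolding quotient_field_def by simp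

lemma R_closed [simp, intro]:
  "\<zero> \<in> carrier R" "\<one> \<in> carrier R"
  "\<lbrakk>x \<in> carrier R; y \<in> carrier R\<rbrakk> \<Longrightarrow> x \<otimes> y \<in> carrier R"
  "\<lbrakk>x \<in> carrier R; y \<in> carrier R\<rbrakk> \<Longrightarrow> x \<oplus> y \<in> carrier R"
  using R.zero_closed R.one_closed R.m_closed[of x y] R.a_closed[of x y] mult_R add_R by auto

lemma neg_R: "x \<in> carrier R \<Longrightarrow> \<ominus>\<^bsub>R\<^esub> x = \<ominus> x"
  using R.l_neg[of x] add_R[of "\<ominus>\<^bsub>R\<^esub> x" x] carrier_subset minus_equality[of "\<ominus>\<^bsub>R\<^esub> x" x]
  by simp

lemma inv_K:
  assumes "x \<in> carrier K" "x \<noteq> \<zero>"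
  shows "inv x \<in> carrier K" "inv x \<noteq> \<zero>" "x \<otimes> inv x = \<one>" "inv x \<otimes> x = \<one>"
proof -
  have "x \<in> Units K" using assms field_Units by auto
  then show "inv x \<in> carrier K" "x \<otimes> inv x = \<one>" "inv x \<otimes> x = \<one>" by auto
  then show "inv x \<noteq> \<zero>" using assms(1) by auto
qed

lemma fraction:
  assumes "x \<in> carrier K"
  obtains a b where "a \<in> carrier R" "b \<in> carrier R" "b \<noteq> \<zero>" "b \<otimes> x = a" "x = a \<otimes> inv b"
proof -
  obtain a b where ab: "a \<in> carrier R" "b \<in> carrier R" "b \<noteq> \<zero>" "x = a \<otimes> inv b"
    using quotient_field assms unfolding quotient_field_def by fastforce
  then have "b \<otimes> x = (b \<otimes> inv b) \<otimes> a"
    using carrier_subset inv_K[of b] by (simp add: m_ac)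
  then have "b \<otimes> x = a" using ab carrier_subset inv_K[of b] by simp
  then show thesis using ab that by blast
qed

text \<open>Closure under negatives comes from multiplication by the negative of
  \<open>\<one>\<close>, which lies in \<open>R\<close>.\<close>

lemma submodule_iff:
  "submodule M R (as_module K) \<longleftrightarrow> M \<subseteq> carrier K \<and> \<zero> \<in> M \<and>
     (\<forall>x\<in>M. \<forall>y\<in>M. x \<oplus> y \<in> M) \<and> (\<forall>r\<in>carrier R. \<forall>x\<in>M. r \<otimes> x \<in> M)" (is "?l \<longleftrightarrow> ?r")
proof -
  have add_m: "m_inv (add_monoid (as_module K)) x = \<ominus> x" for x
    unfolding a_inv_def m_inv_def as_module_def by simp
  show ?thesis
  proof
    assume ?l
    then show ?r
      using submodule.smult_closed[of M R "as_module K"]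
      by (auto simp: submodule_def subgroup_def as_module_def)
  next
    assume r: ?r
    have "\<ominus> x \<in> M" if "x \<in> M" for x
    proof -
      have "\<ominus>\<^bsub>R\<^esub> \<one> \<otimes> x \<in> M" using r that R.a_inv_closed[of \<one>] by auto
      moreover have "\<ominus>\<^bsub>R\<^esub> \<one> \<otimes> x = \<ominus> x" using r that by (auto simp: neg_R l_minus subset_iff)
      ultimately show ?thesis by simp
    qed
    then show ?l using r
      by (intro submodule.intro subgroup.intro submodule_axioms.intro)
        (simp_all add: add_m, simp_all add: as_module_def)
  qed
qed

lemma Fbar_iff:
  "M \<in> Fbar R K \<longleftrightarrow> M \<subseteq> carrier K \<and> \<zero> \<in> M \<and>
     (\<forall>x\<in>M. \<forall>y\<in>M. x \<oplus> y \<in> M) \<and> (\<forall>r\<in>carrier R. \<forall>x\<in>M. r \<otimes> x \<in> M) \<and> (\<exists>x\<in>M. x \<noteq> \<zero>)"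
  unfolding Fbar_def submodule_iff by auto

lemma FbarD:
  assumes "M \<in> Fbar R K"
  shows "M \<subseteq> carrier K" "x \<in> M \<Longrightarrow> x \<in> carrier K" "\<zero> \<in> M"
    "\<lbrakk>x \<in> M; y \<in> M\<rbrakk> \<Longrightarrow> x \<oplus> y \<in> M" "\<lbrakk>r \<in> carrier R; x \<in> M\<rbrakk> \<Longrightarrow> r \<otimes> x \<in> M"
  using assms unfolding Fbar_iff by auto

lemma Fbar_nonzero:
  assumes "M \<in> Fbar R K"
  obtains x where "x \<in> M" "x \<in> carrier K" "x \<noteq> \<zero>"
  using assms unfolding Fbar_iff by auto

text \<open>This lets semistar operations be applied to nonzero ideals.\<close>

lemma ideal_iff:
  "ideal J R \<longleftrightarrow> J \<subseteq> carrier R \<and> submodule J R (as_module K)"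
proof
  assume "ideal J R"
  then interpret J: ideal J R .
  show "J \<subseteq> carrier R \<and> submodule J R (as_module K)"
    unfolding submodule_iff
    using J.Icarr carrier_subset J.zero_closed J.a_closed J.I_l_closed
    by (auto simp flip: mult_R add_R)
next
  assume J: "J \<subseteq> carrier R \<and> submodule J R (as_module K)"
  have *: "r \<otimes> x \<in> J" if "r \<in> carrier R" "x \<in> J" for r x using J that by (auto simp: submodule_iff)
  show "ideal J R"
  proof (rule idealI[OF R.ring_axioms])
    have "\<ominus>\<^bsub>R\<^esub> x \<in> J" if "x \<in> J" for x
    proof -
      have x: "x \<in> carrier R" using J that by auto
      have "\<ominus>\<^bsub>R\<^esub> x = \<ominus>\<^bsub>R\<^esub> \<one> \<otimes> x"
        using x carrier_subset by (simp add: neg_R l_minus)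
      then show ?thesis using *[OF R.a_inv_closed that, of \<one>] by simp
    qed
    then show "subgroup J (add_monoid R)"
      using J by (intro R.add.subgroupI) (auto simp: submodule_iff add_R a_inv_def subset_iff)
    fix a x assume "a \<in> J" "x \<in> carrier R"
    then show "x \<otimes>\<^bsub>R\<^esub> a \<in> J" "a \<otimes>\<^bsub>R\<^esub> x \<in> J"
      using *[of x a] J R.m_comm[of a x] by (auto simp: mult_R)
  qed
qed

lemma ideal_in_Fbar: "\<lbrakk>ideal J R; J \<noteq> {\<zero>}\<rbrakk> \<Longrightarrow> J \<in> Fbar R K"
  unfolding ideal_iff Fbar_def by simp

lemma R_in_Fbar: "carrier R \<in> Fbar R K"
  unfolding Fbar_iff using carrier_subset one_not_zero by blast

lemma K_in_Fbar: "carrier K \<in> Fbar R K"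
  unfolding Fbar_iff using carrier_subset one_not_zero by blast

lemma l_coset_iff:
  assumes "x \<in> carrier K" "x \<noteq> \<zero>" "M \<subseteq> carrier K"
  shows "y \<in> x <# M \<longleftrightarrow> y \<in> carrier K \<and> inv x \<otimes> y \<in> M"
proof
  assume "y \<in> x <# M"
  then obtain m where m: "m \<in> M" "y = x \<otimes> m" by (auto simp: l_coset_def)
  then have "inv x \<otimes> y = m" using assms inv_K[of x] by (simp add: subset_iff flip: m_assoc)
  then show "y \<in> carrier K \<and> inv x \<otimes> y \<in> M" using m assms by auto
next
  assume y: "y \<in> carrier K \<and> inv x \<otimes> y \<in> M"
  then have "y = x \<otimes> (inv x \<otimes> y)" using assms inv_K[of x] by (simp flip: m_assoc)
  then show "y \<in> x <# M" using y by (auto simp: l_coset_def)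
qed

lemma l_coset_in_Fbar:
  assumes x: "x \<in> carrier K" "x \<noteq> \<zero>" and M: "M \<in> Fbar R K"
  shows "x <# M \<in> Fbar R K"
proof -
  note iff = l_coset_iff[OF x FbarD(1)[OF M]]
  obtain m where m: "m \<in> M" "m \<in> carrier K" "m \<noteq> \<zero>" by (rule Fbar_nonzero[OF M])
  have "x \<otimes> m \<in> x <# M" "x \<otimes> m \<noteq> \<zero>" using m x integral by (auto simp: l_coset_def)
  moreover have "r \<otimes> y \<in> x <# M" if "r \<in> carrier R" "y \<in> x <# M" for r y
  proof -
    have "inv x \<otimes> (r \<otimes> y) = r \<otimes> (inv x \<otimes> y)"
      using that iff inv_K[OF x] carrier_subset by (simp add: m_ac)
    then show ?thesis using that iff FbarD(5)[OF M] carrier_subset by simp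
  qed
  moreover have "y \<oplus> z \<in> x <# M" if "y \<in> x <# M" "z \<in> x <# M" for y z
    using that iff inv_K[OF x] FbarD(4)[OF M] by (simp add: r_distr)
  moreover have "\<zero> \<in> x <# M" using iff inv_K[OF x] FbarD(3)[OF M] by simp
  ultimately show ?thesis unfolding Fbar_iff using iff by blast
qed

text \<open>Nonzero \<open>m\<close> in \<open>M\<close> and \<open>n\<close> in \<open>N\<close>
  have a quotient \<open>a / b\<close> with \<open>a\<close> and \<open>b\<close> in
  \<open>R\<close>; then \<open>b \<otimes> m = a \<otimes> n\<close> is a nonzero common
  element.\<close>

lemma Int_in_Fbar:
  assumes M: "M \<in> Fbar R K" and N: "N \<in> Fbar R K"
  shows "M \<inter> N \<in> Fbar R K"
proof -
  obtain m where m: "m \<in> M" "m \<in> carrier K" "m \<noteq> \<zero>" by (rule Fbar_nonzero[OF M])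
  obtain n where n: "n \<in> N" "n \<in> carrier K" "n \<noteq> \<zero>" by (rule Fbar_nonzero[OF N])
  obtain a b where ab: "a \<in> carrier R" "b \<in> carrier R" "b \<noteq> \<zero>" "b \<otimes> (m \<otimes> inv n) = a"
    using fraction[of "m \<otimes> inv n"] m n inv_K(1)[of n] by (metis m_closed)
  have "a \<otimes> n = (b \<otimes> m) \<otimes> (inv n \<otimes> n)"
    using ab(2) m n inv_K[of n] carrier_subset by (simp add: m_ac flip: ab(4))
  then have eq: "a \<otimes> n = b \<otimes> m" using ab(2) m n inv_K[of n] carrier_subset by simp
  have "b \<otimes> m \<in> M \<inter> N"
    using FbarD(5)[OF M ab(2) m(1)] FbarD(5)[OF N ab(1) n(1)] eq by simp
  moreover have "b \<otimes> m \<noteq> \<zero>" using ab m carrier_subset integral by blast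
  ultimately show ?thesis using M N unfolding Fbar_iff by blast
qed

section \<open>Generated submodules and the colon by the whole domain\<close>

lemma gen_submodule_self: "A \<subseteq> gen_submodule R K A"
  unfolding gen_submodule_def by auto

lemma gen_submodule_minimal: "\<lbrakk>submodule M R (as_module K); A \<subseteq> M\<rbrakk> \<Longrightarrow> gen_submodule R K A \<subseteq> M"
  unfolding gen_submodule_def by auto

lemma gen_submodule_in_Fbar:
  assumes "A \<subseteq> carrier K" "a \<in> A" "a \<noteq> \<zero>"
  shows "gen_submodule R K A \<in> Fbar R K"
proof -
  have "submodule (carrier K) R (as_module K)" using K_in_Fbar by (simp add: Fbar_def)
  then have "gen_submodule R K A \<subseteq> carrier K" using gen_submodule_minimal assms(1) by blast
  moreover have "a \<in> gen_submodule R K A" using gen_submodule_self assms(2) by blast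
  moreover have "submodule (gen_submodule R K A) R (as_module K)"
    unfolding submodule_iff
  proof (intro conjI ballI)
    show "gen_submodule R K A \<subseteq> carrier K" by fact
    show "\<zero> \<in> gen_submodule R K A" by (simp add: gen_submodule_def submodule_iff)
    show "x \<oplus> y \<in> gen_submodule R K A"
      if "x \<in> gen_submodule R K A" "y \<in> gen_submodule R K A" for x y
      using that by (simp add: gen_submodule_def submodule_iff)
    show "r \<otimes> x \<in> gen_submodule R K A"
      if "r \<in> carrier R" "x \<in> gen_submodule R K A" for r x
      using that by (simp add: gen_submodule_def submodule_iff)
  qed
  ultimately show ?thesis using assms(3) unfolding Fbar_def by blast
qed

lemma gen_submodule_fg:
  assumes "finite A" "A \<subseteq> carrier K" "a \<in> A" "a \<noteq> \<zero>"
  shows "gen_submodule R K A \<in> fg_Fbar R K"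
  unfolding fg_Fbar_def using assms gen_submodule_in_Fbar[OF assms(2-4)]
  by (intro CollectI conjI exI[of _ A]) simp_all

lemma R_in_fg_Fbar: "carrier R \<in> fg_Fbar R K"
proof -
  have "r \<in> gen_submodule R K {\<one>}" if "r \<in> carrier R" for r
  proof -
    have "r \<otimes> \<one> \<in> gen_submodule R K {\<one>}"
      using gen_submodule_self[of "{\<one>}"] one_not_zero that
      by (intro FbarD(5)[OF gen_submodule_in_Fbar[of _ \<one>]]) auto
    then show ?thesis using carrier_subset[OF that] by simp
  qed
  moreover have "gen_submodule R K {\<one>} \<subseteq> carrier R"
    using R_in_Fbar by (intro gen_submodule_minimal) (auto simp: Fbar_def)
  ultimately have "gen_submodule R K {\<one>} = carrier R" by blast
  then show ?thesis using gen_submodule_fg[of "{\<one>}" \<one>] one_not_zero by simp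
qed

lemma colon_R:
  assumes M: "M \<in> Fbar R K"
  shows "colon K M (carrier R) = M"
proof (intro antisym subsetI)
  fix x assume "x \<in> colon K M (carrier R)"
  then have "x \<in> carrier K" "x <# carrier R \<subseteq> M" by (auto simp: colon_def)
  moreover have "x \<otimes> \<one> \<in> x <# carrier R" using R_closed(2) unfolding l_coset_def by blast
  ultimately have "x \<in> carrier K" "x \<otimes> \<one> \<in> M" by auto
  then show "x \<in> M" by simp
next
  fix x assume x: "x \<in> M"
  then have "x \<otimes> r \<in> M" if "r \<in> carrier R" for r
    using FbarD(2)[OF M x] FbarD(5)[OF M that x] carrier_subset[OF that] m_comm by simp
  then show "x \<in> colon K M (carrier R)" using FbarD(2)[OF M x] by (auto simp: colon_def l_coset_def)
qed

section \<open>Localization at a prime ideal\<close>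

text \<open>The submodule of fractions \<open>i / b\<close> with \<open>i\<close> in
  \<open>I\<close> and \<open>b\<close> outside \<open>P\<close>, written with cleared
  denominators.\<close>

definition localization :: "'a set \<Rightarrow> 'a set \<Rightarrow> 'a set" where
  "localization P = (\<lambda>I\<in>Fbar R K. {y \<in> carrier K. \<exists>b\<in>carrier R - P. b \<otimes> y \<in> I})"

lemma prime_compl:
  assumes "primeideal P R"
  shows "\<one> \<in> carrier R - P" "\<lbrakk>b \<in> carrier R - P; c \<in> carrier R - P\<rbrakk> \<Longrightarrow> b \<otimes> c \<in> carrier R - P"
proof -
  interpret P: primeideal P R by fact
  show "\<one> \<in> carrier R - P" using P.one_imp_carrier P.I_notcarr by auto
  show "b \<otimes> c \<in> carrier R - P" if "b \<in> carrier R - P" "c \<in> carrier R - P"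
    using that P.I_prime[of b c] by (auto simp: mult_R)
qed

lemma localization_iff:
  "I \<in> Fbar R K \<Longrightarrow>
    y \<in> localization P I \<longleftrightarrow> y \<in> carrier K \<and> (\<exists>b\<in>carrier R - P. b \<otimes> y \<in> I)"
  by (simp add: localization_def)

lemma localization_in_Fbar:
  assumes P: "primeideal P R" and I: "I \<in> Fbar R K"
  shows "I \<subseteq> localization P I" "localization P I \<in> Fbar R K"
proof -
  note iff = localization_iff[OF I]
  show sub: "I \<subseteq> localization P I"
    using prime_compl(1)[OF P] FbarD(2)[OF I] by (auto simp: iff intro!: bexI[of _ \<one>])
  have "x \<oplus> y \<in> localization P I" if xy: "x \<in> localization P I" "y \<in> localization P I" for x y
  proof -
    obtain b c where b: "b \<in> carrier R - P" "b \<otimes> x \<in> I" and c: "c \<in> carrier R - P" "c \<otimes> y \<in> I"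
      using xy iff by auto
    have carr: "x \<in> carrier K" "y \<in> carrier K" "b \<in> carrier K" "c \<in> carrier K"
      using xy iff b c carrier_subset by auto
    have "(b \<otimes> c) \<otimes> (x \<oplus> y) = c \<otimes> (b \<otimes> x) \<oplus> b \<otimes> (c \<otimes> y)"
      using carr by (simp add: r_distr m_ac)
    also have "\<dots> \<in> I" using b c FbarD(4,5)[OF I] by simp
    finally show ?thesis using iff carr prime_compl(2)[OF P b(1) c(1)] by blast
  qed
  moreover have "r \<otimes> x \<in> localization P I" if "r \<in> carrier R" and x: "x \<in> localization P I" for r x
  proof -
    obtain b where b: "b \<in> carrier R - P" "b \<otimes> x \<in> I" using x iff by auto
    have carr: "x \<in> carrier K" "b \<in> carrier K" "r \<in> carrier K"
      using x iff b carrier_subset that by auto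
    have "b \<otimes> (r \<otimes> x) = r \<otimes> (b \<otimes> x)" using carr by (simp add: m_ac)
    also have "\<dots> \<in> I" using b that FbarD(5)[OF I] by simp
    finally show ?thesis using iff carr b(1) by blast
  qed
  moreover have "localization P I \<subseteq> carrier K" using iff by blast
  ultimately show "localization P I \<in> Fbar R K"
    using sub I unfolding Fbar_iff by (auto simp: subset_iff)
qed

lemma localization_mono:
  "\<lbrakk>I \<in> Fbar R K; J \<in> Fbar R K; I \<subseteq> J\<rbrakk> \<Longrightarrow> localization P I \<subseteq> localization P J"
  unfolding localization_iff subset_iff by blast

text \<open>Products of denominators outside \<open>P\<close> are again such denominators, which
  gives idempotence. Scaling works because division by \<open>x\<close> commutes with multiplication
  by a denominator.\<close>

lemma localization_semistar:
  assumes P: "primeideal P R"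
  shows "semistar R K (localization P)"
proof -
  note Fbar = localization_in_Fbar[OF P]
  have scale: "localization P (x <# I) = x <# localization P I"
    if I: "I \<in> Fbar R K" and x: "x \<in> carrier K" "x \<noteq> \<zero>" for I x
  proof -
    have "inv x \<otimes> (b \<otimes> y) = b \<otimes> (inv x \<otimes> y)" if "y \<in> carrier K" "b \<in> carrier R" for b y
      using that inv_K[OF x] carrier_subset by (simp add: m_ac)
    then show ?thesis
      using inv_K(1)[OF x] carrier_subset
      by (intro Set.set_eqI) (auto simp: localization_iff[OF I]
          localization_iff[OF l_coset_in_Fbar[OF x I]] l_coset_iff[OF x FbarD(1)[OF I]]
          l_coset_iff[OF x FbarD(1)[OF Fbar(2)[OF I]]])
  qed
  have idem: "localization P (localization P I) = localization P I" if I: "I \<in> Fbar R K" for I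
  proof (rule antisym[OF subsetI Fbar(1)[OF Fbar(2)[OF I]]])
    fix y assume "y \<in> localization P (localization P I)"
    then obtain b c where y: "y \<in> carrier K"
      and b: "b \<in> carrier R - P" and c: "c \<in> carrier R - P" "c \<otimes> (b \<otimes> y) \<in> I"
      by (auto simp: localization_iff[OF Fbar(2)[OF I]] localization_iff[OF I])
    then have "(c \<otimes> b) \<otimes> y \<in> I" using carrier_subset by (simp add: m_assoc)
    then show "y \<in> localization P I"
      using y prime_compl(2)[OF P c(1) b] localization_iff[OF I] by blast
  qed
  have "localization P I = undefined" if "I \<notin> Fbar R K" for I
    using that by (simp add: localization_def)
  then have "localization P \<in> Fbar R K \<rightarrow>\<^sub>E Fbar R K"
    using Fbar(2) by (simp add: PiE_iff extensional_def)
  then show ?thesis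
    unfolding semistar_def using Fbar(1) localization_mono scale idem by simp
qed

text \<open>Denominators \<open>b\<close> for \<open>I\<close> and \<open>c\<close> for
  \<open>J\<close> combine to the common denominator \<open>b \<otimes> c\<close> for
  \<open>I \<inter> J\<close>.\<close>

lemma localization_stable:
  assumes P: "primeideal P R"
  shows "stable_semistar R K (localization P)"
  unfolding stable_semistar_def
proof (intro ballI antisym subsetI)
  fix I J y assume I: "I \<in> Fbar R K" and J: "J \<in> Fbar R K"
  note iff = localization_iff[OF I] localization_iff[OF J] localization_iff[OF Int_in_Fbar[OF I J]]
  show "y \<in> localization P I \<inter> localization P J" if "y \<in> localization P (I \<inter> J)"
    using that by (auto simp: iff)
  assume "y \<in> localization P I \<inter> localization P J"
  then obtain b c where y: "y \<in> carrier K"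
    and b: "b \<in> carrier R - P" "b \<otimes> y \<in> I" and c: "c \<in> carrier R - P" "c \<otimes> y \<in> J"
    by (auto simp: iff)
  have "(b \<otimes> c) \<otimes> y = c \<otimes> (b \<otimes> y)" "(b \<otimes> c) \<otimes> y = b \<otimes> (c \<otimes> y)"
    using y b c carrier_subset by (simp_all add: m_ac)
  moreover have "c \<otimes> (b \<otimes> y) \<in> I" "b \<otimes> (c \<otimes> y) \<in> J"
    using b c FbarD(5)[OF I] FbarD(5)[OF J] by blast+
  ultimately have "(b \<otimes> c) \<otimes> y \<in> I \<inter> J" by (metis IntI)
  then show "y \<in> localization P (I \<inter> J)" using y prime_compl(2)[OF P b(1) c(1)] iff(3) by blast
qed

text \<open>Membership of \<open>y\<close> is witnessed by the single element
  \<open>b \<otimes> y\<close> of \<open>I\<close>, so a finitely generated part of \<open>I\<close>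
  suffices.\<close>

lemma localization_finite_type:
  assumes P: "primeideal P R"
  shows "finite_type R K (localization P)"
  unfolding finite_type_def
proof
  fix I
  show "localization P I = semistar_f R K (localization P) I"
  proof (cases "I \<in> Fbar R K")
    case I: True
    have "localization P I \<subseteq> \<Union>{localization P J |J. J \<in> fg_Fbar R K \<and> J \<subseteq> I}"
    proof
      fix y assume "y \<in> localization P I"
      then obtain b where y: "y \<in> carrier K" and b: "b \<in> carrier R - P" "b \<otimes> y \<in> I"
        by (auto simp: localization_iff[OF I])
      \<comment> \<open>This extra generator keeps \<open>J\<close> nonzero when
        \<open>y = \<zero>\<close>.\<close>
      obtain z where z: "z \<in> I" "z \<in> carrier K" "z \<noteq> \<zero>" by (rule Fbar_nonzero[OF I])
      define J where "J = gen_submodule R K {z, b \<otimes> y}"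
      have J: "J \<in> fg_Fbar R K"
        unfolding J_def using z y b carrier_subset by (intro gen_submodule_fg[of _ z]) auto
      moreover have "J \<subseteq> I"
        unfolding J_def using I z b by (intro gen_submodule_minimal) (auto simp: Fbar_def)
      moreover have "b \<otimes> y \<in> J" unfolding J_def using gen_submodule_self by blast
      moreover have "J \<in> Fbar R K" using J by (simp add: fg_Fbar_def)
      ultimately show "y \<in> \<Union>{localization P J |J. J \<in> fg_Fbar R K \<and> J \<subseteq> I}"
        using y b(1) localization_iff[of J y P] by blast
    qed
    moreover have "\<Union>{localization P J |J. J \<in> fg_Fbar R K \<and> J \<subseteq> I} \<subseteq> localization P I"
    proof (intro Union_least, clarify)
      fix J x assume "J \<in> fg_Fbar R K" "J \<subseteq> I" "x \<in> localization P J"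
      then show "x \<in> localization P I" using localization_mono[of J I P] I by (auto simp: fg_Fbar_def)
    qed
    ultimately show ?thesis using I by (simp add: semistar_f_def)
  qed (simp add: semistar_f_def localization_def)
qed

section \<open>Stable operations and the tilde operation\<close>

text \<open>Localization at a nonzero prime \<open>P\<close> is not \<open>e\<close>: for nonzero
  \<open>p\<close> in \<open>P\<close>, the inverse of \<open>p\<close> has no denominator outside
  \<open>P\<close>. So it is \<open>d\<close> and leaves \<open>R\<close> fixed, which makes all
  elements outside \<open>P\<close> units. Every nonzero prime is therefore the set of
  nonunits.\<close>

lemma unique_primeI_stable_finite_type:
  assumes "\<not> field R"
    and ops: "\<And>s. \<lbrakk>semistar R K s; stable_semistar R K s; finite_type R K s\<rbrakk>
      \<Longrightarrow> s = semistar_e R K \<or> s = semistar_d R K"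
  shows "\<exists>!P. primeideal P R \<and> P \<noteq> {\<zero>}"
proof -
  have nonunits: "P = carrier R - Units R" if P: "primeideal P R" "P \<noteq> {\<zero>}" for P
  proof -
    interpret P: primeideal P R by (rule P)
    obtain p where p: "p \<in> P" "p \<noteq> \<zero>" using P(2) P.zero_closed by auto
    have pR: "p \<in> carrier R" using p P.Icarr by blast
    have "localization P \<noteq> semistar_e R K"
    proof
      assume "localization P = semistar_e R K"
      then have "inv p \<in> localization P (carrier R)"
        using inv_K[of p] pR carrier_subset p(2) R_in_Fbar by (simp add: semistar_e_def)
      then obtain b where b: "b \<in> carrier R - P" "b \<otimes> inv p \<in> carrier R"
        using localization_iff[OF R_in_Fbar] by auto
      have "(b \<otimes> inv p) \<otimes> p = b"
        using b(1) pR p(2) carrier_subset inv_K[of p] by (simp add: m_assoc)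
      then have "b \<in> P" using P.I_l_closed[OF p(1) b(2)] pR b(2) by (simp add: mult_R)
      then show False using b(1) by auto
    qed
    then have "localization P = semistar_d R K"
      using ops localization_semistar localization_stable localization_finite_type P(1) by blast
    then have loc: "localization P (carrier R) = carrier R"
      using R_in_Fbar by (simp add: semistar_d_def)
    have "b \<in> Units R" if b: "b \<in> carrier R - P" for b
    proof -
      have "b \<noteq> \<zero>" using b P.zero_closed by auto
      note inv_b = inv_K[of b, OF carrier_subset this]
      have "inv b \<in> carrier R"
        using b inv_b localization_iff[OF R_in_Fbar, of "inv b" P] loc by auto
      then show ?thesis using b inv_b by (auto simp: Units_def mult_R intro!: bexI[of _ "inv b"])
    qed
    moreover have "b \<notin> Units R" if "b \<in> P" for b
    proof
      assume "b \<in> Units R"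
      then obtain x where "x \<in> carrier R" "b \<otimes>\<^bsub>R\<^esub> x = \<one>\<^bsub>R\<^esub>" by (auto simp: Units_def)
      then have "\<one>\<^bsub>R\<^esub> \<in> P" using P.I_r_closed[OF that] by metis
      then show False using P.one_imp_carrier P.I_notcarr by blast
    qed
    ultimately show ?thesis using P.Icarr by blast
  qed
  obtain P where "primeideal P R" "P \<noteq> {\<zero>}"
    using R.exists_nonzero_primeideal[OF assms(1)] zero_R by metis
  then show ?thesis using nonunits by (intro ex1I[of _ P]) auto
qed

section \<open>Comparison of semistar operations with the tilde operation\<close>

lemma semistarD:
  assumes "semistar R K s"
  shows "I \<in> Fbar R K \<Longrightarrow> s I \<in> Fbar R K"
    and "I \<in> Fbar R K \<Longrightarrow> I \<subseteq> s I"
    and "\<lbrakk>I \<in> Fbar R K; J \<in> Fbar R K; I \<subseteq> J\<rbrakk> \<Longrightarrow> s I \<subseteq> s J"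
    and "\<lbrakk>I \<in> Fbar R K; x \<in> carrier K; x \<noteq> \<zero>\<rbrakk> \<Longrightarrow> s (x <# I) = x <# s I"
    and "I \<in> Fbar R K \<Longrightarrow> s (s I) = s I"
    and "I \<notin> Fbar R K \<Longrightarrow> s I = undefined"
  using assms unfolding semistar_def by (auto simp: PiE_iff extensional_def)

text \<open>The submodule \<open>s I\<close> then contains \<open>R\<close>; apply \<open>s\<close>
  to this inclusion and use idempotence.\<close>

lemma semistar_one_mem:
  assumes s: "semistar R K s" and I: "I \<in> Fbar R K" and "\<one> \<in> s I"
  shows "s (carrier R) \<subseteq> s I"
proof -
  have "r \<in> s I" if "r \<in> carrier R" for r
    using FbarD(5)[OF semistarD(1)[OF s I] that assms(3)] carrier_subset[OF that] by simp
  then have "s (carrier R) \<subseteq> s (s I)"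
    by (intro semistarD(3)[OF s R_in_Fbar semistarD(1)[OF s I]]) blast
  then show ?thesis using semistarD(5)[OF s I] by simp
qed

text \<open>For nonzero \<open>x\<close> in \<open>s I\<close>, take
  \<open>J = (inv x <# I) \<inter> carrier R\<close>. Scaling puts \<open>\<one>\<close> into
  \<open>s (inv x <# I)\<close> and stability puts it into \<open>s J\<close>, so
  \<open>s J = s (carrier R)\<close>; moreover \<open>x\<close> multiplies \<open>J\<close> into
  \<open>I\<close>. Finite type identifies \<open>semistar_f R K s\<close> with
  \<open>s\<close>.\<close>

lemma semistar_subset_tilde:
  assumes s: "semistar R K s" "stable_semistar R K s" "finite_type R K s" and I: "I \<in> Fbar R K"
  shows "s I \<subseteq> semistar_tilde R K s I"
proof
  fix x assume x: "x \<in> s I"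
  have sf: "semistar_f R K s = s" using s(3) by (simp add: finite_type_def)
  have xK: "x \<in> carrier K" using FbarD(2)[OF semistarD(1)[OF s(1) I] x] .
  have "\<exists>J. ideal J R \<and> J \<noteq> {\<zero>} \<and> s J = s (carrier R) \<and> x \<in> colon K I J"
  \<comment> \<open>Zero cannot be inverted; for it the ideal \<open>carrier R\<close> serves as
    \<open>J\<close>.\<close>
  proof (cases "x = \<zero>")
    case True
    then have "x \<in> colon K I (carrier R)" using colon_R[OF I] FbarD(3)[OF I] by simp
    then show ?thesis using R.oneideal one_not_zero R_closed(2) by blast
  next
    case False
    define M where "M = inv x <# I"
    note inv_x = inv_K[OF xK False]
    have M: "M \<in> Fbar R K" unfolding M_def using inv_x I by (intro l_coset_in_Fbar)
    have J: "M \<inter> carrier R \<in> Fbar R K" using Int_in_Fbar[OF M R_in_Fbar] .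
    have ideal: "ideal (M \<inter> carrier R) R" and nz: "M \<inter> carrier R \<noteq> {\<zero>}"
      using J unfolding ideal_iff Fbar_def by auto
    have "inv x \<otimes> x \<in> inv x <# s I" using x unfolding l_coset_def by blast
    then have "\<one> \<in> s M"
      using semistarD(4)[OF s(1) I inv_x(1,2)] inv_x(4) unfolding M_def by simp
    moreover have "\<one> \<in> s (carrier R)" using semistarD(2)[OF s(1) R_in_Fbar] by auto
    ultimately have "\<one> \<in> s (M \<inter> carrier R)"
      using s(2) M R_in_Fbar unfolding stable_semistar_def by simp
    then have "s (carrier R) \<subseteq> s (M \<inter> carrier R)" by (rule semistar_one_mem[OF s(1) J])
    then have eq: "s (M \<inter> carrier R) = s (carrier R)"
      using semistarD(3)[OF s(1) J R_in_Fbar] by auto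
    have "x \<otimes> r \<in> I" if r: "r \<in> M" for r
    proof -
      obtain i where i: "i \<in> I" "r = inv x \<otimes> i" using r by (auto simp: M_def l_coset_def)
      then have "x \<otimes> r = i" using xK inv_x FbarD(2)[OF I] by (simp flip: m_assoc)
      then show ?thesis using i by simp
    qed
    then have "x \<in> colon K I (M \<inter> carrier R)" using xK by (auto simp: colon_def l_coset_def)
    then show ?thesis using ideal nz eq by blast
  qed
  then show "x \<in> semistar_tilde R K s I" using I unfolding semistar_tilde_def sf by auto
qed

text \<open>The element \<open>\<one>\<close> lies in \<open>s G\<close> for some finitely generated
  \<open>G \<subseteq> J\<close>. This starts the family of ideals whose closure contains
  \<open>\<one>\<close>, which then contains all nonzero principal ideals. Hence inverses of nonzero
  elements of \<open>R\<close> lie in \<open>s (carrier R)\<close>, which is therefore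
  \<open>carrier K\<close>, and scaling carries this to every submodule.\<close>

lemma semistar_eq_e:
  assumes unique: "\<exists>!P. primeideal P R \<and> P \<noteq> {\<zero>}" and s: "semistar R K s"
    and J: "ideal J R" "J \<noteq> {\<zero>}" "J \<noteq> carrier R" "semistar_f R K s J = s (carrier R)"
  shows "s = semistar_e R K"
proof -
  have JF: "J \<in> Fbar R K" using ideal_in_Fbar J by blast
  have one: "\<one> \<in> s (carrier R)" using semistarD(2)[OF s R_in_Fbar] by auto
  then have "\<one> \<in> \<Union>{s F |F. F \<in> fg_Fbar R K \<and> F \<subseteq> J}"
    using J(4) JF by (simp add: semistar_f_def)
  then obtain G where "G \<in> fg_Fbar R K" and GJ: "G \<subseteq> J" "\<one> \<in> s G" by auto
  then obtain A where G: "G \<in> Fbar R K" and A: "finite A" "G = gen_submodule R K A"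
    unfolding fg_Fbar_def by blast
  have AJ: "A \<subseteq> J" using A GJ gen_submodule_self by blast
  then have AR: "A \<subseteq> carrier R" using ideal.Icarr[OF J(1)] by auto
  \<comment> \<open>The ideal generated by \<open>A\<close> is placed between \<open>G\<close> and
    \<open>J\<close>: it belongs to the family because it contains \<open>G\<close>, and it is
    proper because \<open>J\<close> is.\<close>
  have IdlA: "ideal (Idl\<^bsub>R\<^esub> A) R" "A \<subseteq> Idl\<^bsub>R\<^esub> A" "Idl\<^bsub>R\<^esub> A \<subseteq> J"
    using R.genideal_ideal[OF AR] R.genideal_self[OF AR] R.genideal_minimal[OF J(1) AJ] by auto
  have GA: "G \<subseteq> Idl\<^bsub>R\<^esub> A" unfolding A(2) using IdlA ideal_iff by (intro gen_submodule_minimal) auto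
  define F where "F = (\<lambda>I. ideal I R \<and> I \<noteq> {\<zero>} \<and> \<one> \<in> s I)"
  have F_all: "F I" if I: "ideal I R" "I \<noteq> {\<zero>\<^bsub>R\<^esub>}" for I
  proof (rule R.ideal_family_top_or_all[where F = F, OF _ _ _ _ A(1) AR _ _ I])
    show "\<exists>!P. primeideal P R \<and> P \<noteq> {\<zero>\<^bsub>R\<^esub>}" using unique by simp
    show "ideal I R" if "F I" for I using that by (simp add: F_def)
    show mono: "F C" if B: "F B" "B \<subseteq> C" and C: "ideal C R" for B C
    proof -
      have BF: "B \<in> Fbar R K" using B ideal_in_Fbar by (auto simp: F_def)
      then obtain x where "x \<in> B" "x \<noteq> \<zero>" by (rule Fbar_nonzero)
      then have nz: "C \<noteq> {\<zero>}" using B by auto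
      then show ?thesis
        using semistarD(3)[OF s BF ideal_in_Fbar[OF C nz] B(2)] B C by (auto simp: F_def)
    qed
    show "F (B \<cdot>\<^bsub>R\<^esub> C)" if F: "F B" "F C" for B C
    proof -
      have B: "B \<in> Fbar R K" "ideal B R" "\<one> \<in> s B" and C: "C \<in> Fbar R K" "ideal C R" "\<one> \<in> s C"
        using F ideal_in_Fbar by (auto simp: F_def)
      have BC: "ideal (B \<cdot>\<^bsub>R\<^esub> C) R" using R.ideal_prod_is_ideal B C by blast
      have prod: "c \<otimes> b \<in> B \<cdot>\<^bsub>R\<^esub> C" if "b \<in> B" "c \<in> C" for b c
        using ideal_prod.prod[OF that, of R] ideal.Icarr[OF B(2) that(1)] ideal.Icarr[OF C(2) that(2)]
          mult_R[of b c] R.m_comm[of b c] mult_R[of c b] by simp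
      obtain b where b: "b \<in> B" "b \<in> carrier K" "b \<noteq> \<zero>" by (rule Fbar_nonzero[OF B(1)])
      obtain c where c: "c \<in> C" "c \<in> carrier K" "c \<noteq> \<zero>" by (rule Fbar_nonzero[OF C(1)])
      have "c \<otimes> b \<noteq> \<zero>" using b c integral by blast
      then have nz: "B \<cdot>\<^bsub>R\<^esub> C \<noteq> {\<zero>}" using prod[OF b(1) c(1)] by auto
      have BCF: "B \<cdot>\<^bsub>R\<^esub> C \<in> Fbar R K" using ideal_in_Fbar[OF BC nz] .
      \<comment> \<open>Scaling \<open>B\<close> by \<open>d\<close> lands in the product, so
        \<open>d = d \<otimes> \<one>\<close> lies in \<open>d <# s B\<close> and thus in the
        closure of the product. Hence that closure contains \<open>C\<close>, and by idempotence
        also \<open>s C\<close>, where \<open>\<one>\<close> lies.\<close>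
      have "d \<in> s (B \<cdot>\<^bsub>R\<^esub> C)" if d: "d \<in> C" for d
      proof (cases "d = \<zero>")
        case True
        then show ?thesis using FbarD(3) semistarD(1)[OF s BCF] by blast
      next
        case False
        have dK: "d \<in> carrier K" using d FbarD(2)[OF C(1)] by blast
        have "d <# B \<subseteq> B \<cdot>\<^bsub>R\<^esub> C" using prod d by (auto simp: l_coset_def)
        then have "d <# s B \<subseteq> s (B \<cdot>\<^bsub>R\<^esub> C)"
          using semistarD(3)[OF s l_coset_in_Fbar[OF dK False B(1)] BCF]
            semistarD(4)[OF s B(1) dK False] by simp
        moreover have "d \<otimes> \<one> \<in> d <# s B" using B(3) by (auto simp: l_coset_def)
        ultimately show ?thesis using dK by auto
      qed
      then have "s C \<subseteq> s (s (B \<cdot>\<^bsub>R\<^esub> C))"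
        by (intro semistarD(3)[OF s C(1) semistarD(1)[OF s BCF]]) blast
      then show ?thesis using BC nz C(3) semistarD(5)[OF s BCF] by (auto simp: F_def)
    qed
    obtain g where g: "g \<in> G" "g \<in> carrier K" "g \<noteq> \<zero>" by (rule Fbar_nonzero[OF G])
    then have nz: "Idl\<^bsub>R\<^esub> A \<noteq> {\<zero>}" using GA by auto
    show "F (Idl\<^bsub>R\<^esub> A)"
      using semistarD(3)[OF s G ideal_in_Fbar[OF IdlA(1) nz] GA] GJ(2) IdlA(1) nz
      by (auto simp: F_def)
    show "Idl\<^bsub>R\<^esub> A \<noteq> carrier R" using IdlA(3) J(3) ideal.Icarr[OF J(1)] by blast
  qed
  \<comment> \<open>The principal ideal \<open>x <# carrier R\<close> belongs to the family, so
    \<open>\<one>\<close> lies in \<open>x <# s (carrier R)\<close>; divide by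
    \<open>x\<close>.\<close>
  have inv_mem: "inv x \<in> s (carrier R)" if x: "x \<in> carrier R" "x \<noteq> \<zero>" for x
  proof -
    have xK: "x \<in> carrier K" using x carrier_subset by blast
    have xR: "x <# carrier R \<in> Fbar R K" using l_coset_in_Fbar[OF xK x(2) R_in_Fbar] .
    moreover have "x <# carrier R \<subseteq> carrier R" using x by (auto simp: l_coset_def)
    ultimately have "ideal (x <# carrier R) R" "x <# carrier R \<noteq> {\<zero>}"
      unfolding ideal_iff Fbar_def by auto
    then have "\<one> \<in> s (x <# carrier R)" using F_all by (simp add: F_def)
    then show ?thesis
      using semistarD(4)[OF s R_in_Fbar xK x(2)]
        l_coset_iff[OF xK x(2) FbarD(1)[OF semistarD(1)[OF s R_in_Fbar]]] inv_K(1)[OF xK x(2)] by simp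
  qed
  have K: "y \<in> s (carrier R)" if "y \<in> carrier K" for y
  proof -
    obtain a b where "a \<in> carrier R" "b \<in> carrier R" "b \<noteq> \<zero>" "b \<otimes> y = a" "y = a \<otimes> inv b"
      by (rule fraction[OF \<open>y \<in> carrier K\<close>])
    then show ?thesis using FbarD(5)[OF semistarD(1)[OF s R_in_Fbar], of a "inv b"] inv_mem[of b] by simp
  qed
  have "s I = carrier K" if I: "I \<in> Fbar R K" for I
  proof
    show "s I \<subseteq> carrier K" using FbarD(1)[OF semistarD(1)[OF s I]] .
    obtain y where y: "y \<in> I" "y \<in> carrier K" "y \<noteq> \<zero>" by (rule Fbar_nonzero[OF I])
    have "y <# carrier R \<subseteq> I"
    proof
      fix z assume "z \<in> y <# carrier R"
      then obtain r where "r \<in> carrier R" "z = y \<otimes> r" by (auto simp: l_coset_def)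
      then show "z \<in> I" using FbarD(5)[OF I, of r y] y m_comm[of y r] carrier_subset by simp
    qed
    then have sub: "y <# s (carrier R) \<subseteq> s I"
      using semistarD(3)[OF s l_coset_in_Fbar[OF y(2,3) R_in_Fbar] I]
        semistarD(4)[OF s R_in_Fbar y(2,3)] by simp
    show "carrier K \<subseteq> s I"
    proof
      fix z assume "z \<in> carrier K"
      then have "z \<in> y <# s (carrier R)"
        using l_coset_iff[OF y(2,3) FbarD(1)[OF semistarD(1)[OF s R_in_Fbar]]]
          inv_K(1)[OF y(2,3)] K by simp
      then show "z \<in> s I" using sub by blast
    qed
  qed
  then show ?thesis using semistarD(6)[OF s] by (auto simp: semistar_e_def fun_eq_iff)
qed

text \<open>\<open>R\<close> is finitely generated, so the union attains its largest member at
  \<open>R\<close> itself. Hence \<open>R\<close> always takes part in the tilde operation.\<close>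

lemma semistar_f_R:
  assumes s: "semistar R K s"
  shows "semistar_f R K s (carrier R) = s (carrier R)"
proof -
  have "s J \<subseteq> s (carrier R)" if "J \<in> fg_Fbar R K" "J \<subseteq> carrier R" for J
    using that semistarD(3)[OF s _ R_in_Fbar] by (simp add: fg_Fbar_def)
  then show ?thesis using R_in_Fbar R_in_fg_Fbar by (fastforce simp: semistar_f_def)
qed

text \<open>A proper ideal in the union would force \<open>e\<close>, so only the colon by
  \<open>R\<close> remains, and it returns \<open>I\<close>.\<close>

lemma semistar_tilde_eq_d:
  assumes unique: "\<exists>!P. primeideal P R \<and> P \<noteq> {\<zero>}"
    and s: "semistar R K s" "s \<noteq> semistar_e R K"
  shows "semistar_tilde R K s = semistar_d R K"
proof -
  have "{colon K I J |J. ideal J R \<and> J \<noteq> {\<zero>} \<and> semistar_f R K s J = s (carrier R)}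
      = {colon K I (carrier R)}" for I
    using semistar_eq_e[OF unique s(1)] s(2) R.oneideal semistar_f_R[OF s(1)] one_not_zero R_closed(2)
    by blast
  then show ?thesis unfolding semistar_tilde_def semistar_d_def
    by (auto simp: colon_R fun_eq_iff)
qed

text \<open>\<open>s I\<close> lies between \<open>I\<close> and its tilde closure, and these two
  coincide.\<close>

lemma stable_finite_type_eq_d:
  assumes "semistar R K s" "stable_semistar R K s" "finite_type R K s"
    and "semistar_tilde R K s = semistar_d R K"
  shows "s = semistar_d R K"
proof
  fix I
  show "s I = semistar_d R K I"
  proof (cases "I \<in> Fbar R K")
    case True
    then show ?thesis
      using semistar_subset_tilde[OF assms(1-3) True] semistarD(2)[OF assms(1) True] assms(4)
      by (auto simp: semistar_d_def)
  next
    case False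
    then show ?thesis using semistarD(6)[OF assms(1)] by (simp add: semistar_d_def)
  qed
qed

end

section \<open>Equivalence of the conditions through the unique nonzero prime\<close>

theorem theorem4:
  fixes R :: "('a, 'm) ring_scheme" and K :: "('a, 'n) ring_scheme"
  assumes "domain R" and "\<not> field R" and "quotient_field R K"
  shows
    "((quasi_local_domain R \<and> krull_dim R = 1) \<longleftrightarrow>
        (\<forall>s. semistar R K s \<and> s \<noteq> semistar_e R K \<longrightarrow> semistar_tilde R K s = semistar_d R K)) \<and>
     ((quasi_local_domain R \<and> krull_dim R = 1) \<longleftrightarrow>
        (\<forall>s. semistar R K s \<and> stable_semistar R K s \<and> finite_type R K s \<longrightarrow>
             s = semistar_e R K \<or> s = semistar_d R K)) \<and>
     ((quasi_local_domain R \<and> krull_dim R = 1) \<longleftrightarrow>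
        (\<forall>v. ideal_valuation R v \<longrightarrow> constant_on_proper_ideals R v)) \<and>
     ((quasi_local_domain R \<and> krull_dim R = 1) \<longleftrightarrow>
        (\<forall>h. prime_valuation R h \<longrightarrow> constant_on_nonzero_primes R h) \<and>
        (\<exists>v I. ideal_valuation R v \<and> ideal I R \<and> v I \<noteq> 0))"
proof -
  have "field K" using assms(3) by (simp add: quotient_field_def)
  then interpret domain_with_quotient_field K R
    using assms by (intro domain_with_quotient_field.intro domain_with_quotient_field_axioms.intro)
  let ?U = "\<exists>!P. primeideal P R \<and> P \<noteq> {\<zero>\<^bsub>R\<^esub>}"
  let ?T = "\<forall>s. semistar R K s \<and> s \<noteq> semistar_e R K \<longrightarrow> semistar_tilde R K s = semistar_d R K"
  let ?S = "\<forall>s. semistar R K s \<and> stable_semistar R K s \<and> finite_type R K s \<longrightarrow>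
             s = semistar_e R K \<or> s = semistar_d R K"
  let ?V = "(\<forall>h. prime_valuation R h \<longrightarrow> constant_on_nonzero_primes R h) \<and>
        (\<exists>v I. ideal_valuation R v \<and> ideal I R \<and> v I \<noteq> 0)"
  have 12: "?U \<Longrightarrow> ?T" using semistar_tilde_eq_d by simp
  have 23: "?T \<Longrightarrow> ?S" using stable_finite_type_eq_d by blast
  have 31: "?S \<Longrightarrow> ?U" using unique_primeI_stable_finite_type[OF assms(2)] by simp
  have 14: "?U \<longleftrightarrow> (\<forall>v. ideal_valuation R v \<longrightarrow> constant_on_proper_ideals R v)"
    using R.ideal_valuation_constant R.unique_primeI_ideal_valuations[OF assms(2)] by blast
  have 15: "?U \<Longrightarrow> ?V"
  proof
    assume U: ?U
    then obtain P where P: "primeideal P R"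
      and unique: "\<And>Q. \<lbrakk>primeideal Q R; Q \<noteq> {\<zero>\<^bsub>R\<^esub>}\<rbrakk> \<Longrightarrow> Q = P" by auto
    \<comment> \<open>With a single nonzero prime, the value at it serves as the constant for any
      function.\<close>
    have "constant_on_nonzero_primes R h" for h
      unfolding constant_on_nonzero_primes_def Spec_def
      using unique by (intro exI[of _ "h P"]) blast
    then show "\<forall>h. prime_valuation R h \<longrightarrow> constant_on_nonzero_primes R h" by blast
    from P have v: "ideal_valuation R (\<lambda>I. if I \<subseteq> P then 0 else \<infinity>)"
      by (rule R.ideal_valuation_of_prime)
    then have "(if carrier R \<subseteq> P then 0 else \<infinity>) = (\<infinity>::enat)"
      unfolding ideal_valuation_def by blast
    then have "(if carrier R \<subseteq> P then 0 else \<infinity>) \<noteq> (0::enat)" by simp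
    then show "\<exists>v I. ideal_valuation R v \<and> ideal I R \<and> v I \<noteq> (0::enat)"
      using v R.oneideal by (intro exI conjI)
  qed
  have 51: "?V \<Longrightarrow> ?U" using R.unique_primeI_prime_valuations[OF assms(2)] by blast
  show ?thesis unfolding R.one_dim_quasi_local_iff[OF assms(2)]
  proof (intro conjI)
    show "?U \<longleftrightarrow> ?T" by (rule iffI, erule 12, rule 31, erule 23)
    show "?U \<longleftrightarrow> ?S" by (rule iffI, rule 23, erule 12, erule 31)
    show "?U \<longleftrightarrow> ?V" by (rule iffI, erule 15, erule 51)
  qed (rule 14)
qed

end
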